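(* Let $p$ be a prime and let $G$ be a connected $p$-periodic graph with $q$ edges. Then, modulo $p$, the Negami polynomial $N_G(u,x,y)$ is congruent to a polynomial of the form $\sum_{(i,j)} c_{i,j}\, u^{i}x^{q-jp}y^{jp}$ with integer coefficients $c_{i,j}$ (summing over finitely many pairs of nonnegative integers $(i,j)$); that is, every monomial of $N_G(u,x,y)$ whose coefficient is nonzero modulo $p$ has the form $u^i x^{q-jp}y^{jp}$ for some nonnegative integers $i,j$.
   Context: Graphs are finite 1-dimensional CW-complexes (loops and multiple edges are allowed). For an integer $p\ge 2$, a graph $G$ is called $p$-periodic if its automorphism group contains an element $h$ of order $p$ such that no edge of $G$ is mapped to itself by any nontrivial element of the cyclic group $\langle h\rangle\cong\mathbb{Z}_p$ (i.e. the induced action of $\mathbb{Z}_p$ on the edge set is fixed-point free). For a graph $G$ with edge set $E(G)$ and $q$ edges, the Negami polynomial is $N_G(u,x,y)=\sum_{Y\subseteq E(G)} u^{w(G-Y)}x^{q-|Y|}y^{|Y|}$, where $w(G-Y)$ denotes the number of connected components of the graph $G-Y$ obtained from $G$ by removing the edges in $Y$ (keeping all vertices). *)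

theory Defs
  imports
    "HOL-Algebra.Bij"
    "HOL-Algebra.Generated_Groups"
    "HOL-Algebra.Multiplicative_Group"
    "HOL-Computational_Algebra.Primes"
    "HOL-Library.Poly_Mapping"
    "HOL-Library.Product_Plus"
begin

section \<open>Finite graphs with loops and multiple edges\<close>

record ('v, 'e) multigraph =
  verts :: "'v set"
  edges :: "'e set"
  ends :: "'e \<Rightarrow> 'v set"

text \<open>
  A finite 1-dimensional CW-complex is encoded by its 0-cells, its 1-cells and, for every 1-cell,
  the set of its end points, which is a singleton exactly for loops.
\<close>

locale finite_multigraph =
  fixes G :: "('v, 'e) multigraph"
  assumes finite_verts: "finite (verts G)"
    and finite_edges: "finite (edges G)"
    and ends_subset: "e \<in> edges G \<Longrightarrow> ends G e \<subseteq> verts G"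
    and card_ends: "e \<in> edges G \<Longrightarrow> card (ends G e) \<in> {1, 2}"

definition delete_edges :: "('v, 'e) multigraph \<Rightarrow> 'e set \<Rightarrow> ('v, 'e) multigraph" where
  "delete_edges G Y = G\<lparr>edges := edges G - Y\<rparr>"

definition adjacency :: "('v, 'e) multigraph \<Rightarrow> ('v \<times> 'v) set" where
  "adjacency G = {(a, b). \<exists>e\<in>edges G. ends G e = {a, b}}"

definition connectivity :: "('v, 'e) multigraph \<Rightarrow> ('v \<times> 'v) set" where
  "connectivity G = {(a, b) \<in> verts G \<times> verts G. (a, b) \<in> (adjacency G)\<^sup>*}"

lemma equiv_connectivity: "equiv (verts G) (connectivity G)"
proof (rule equivI)
  have "sym (adjacency G)"
    by (auto simp: adjacency_def sym_def insert_commute)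
  then show "sym (connectivity G)"
    unfolding connectivity_def by (auto intro!: symI dest: sym_rtrancl symD)
  show "trans (connectivity G)"
    unfolding connectivity_def by (auto intro!: transI)
qed (auto simp: connectivity_def refl_on_def)

definition num_components :: "('v, 'e) multigraph \<Rightarrow> nat" where
  "num_components G = card (verts G // connectivity G)"

text \<open>In particular, the empty graph does not count as connected.\<close>

definition connected_multigraph :: "('v, 'e) multigraph \<Rightarrow> bool" where
  "connected_multigraph G \<longleftrightarrow> num_components G = 1"


section \<open>Automorphisms and periodicity\<close>

text \<open>
  An automorphism permutes vertices and edges compatibly with incidence.  The edge permutation is
  not determined by the vertex permutation, because of loops and multiple edges.
\<close>

definition automorphisms :: "('v, 'e) multigraph \<Rightarrow> (('v \<Rightarrow> 'v) \<times> ('e \<Rightarrow> 'e)) set" where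
  "automorphisms G =
     {(f, g). f \<in> Bij (verts G) \<and> g \<in> Bij (edges G) \<and>
              (\<forall>e\<in>edges G. ends G (g e) = f ` ends G e)}"

definition AutGroup :: "('v, 'e) multigraph \<Rightarrow> (('v \<Rightarrow> 'v) \<times> ('e \<Rightarrow> 'e)) monoid" where
  "AutGroup G =
     (BijGroup (verts G) \<times>\<times> BijGroup (edges G))\<lparr>carrier := automorphisms G\<rparr>"

lemma (in finite_multigraph) group_AutGroup: "group (AutGroup G)"
proof -
  let ?P = "BijGroup (verts G) \<times>\<times> BijGroup (edges G)"
  interpret P: group ?P
    by (intro DirProd_group group_BijGroup)
  have "subgroup (automorphisms G) ?P"
  proof (rule P.subgroupI)
    show "automorphisms G \<subseteq> carrier ?P"
      by (auto simp: automorphisms_def BijGroup_def)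
    have "(\<lambda>x\<in>verts G. x) ` ends G e = ends G e" if "e \<in> edges G" for e
      using ends_subset[OF that] by force
    then have "\<one>\<^bsub>?P\<^esub> \<in> automorphisms G"
      by (auto simp: automorphisms_def BijGroup_def id_Bij)
    then show "automorphisms G \<noteq> {}"
      by blast
  next
    fix a assume "a \<in> automorphisms G"
    then obtain f g where a: "a = (f, g)" and f: "f \<in> Bij (verts G)" and g: "g \<in> Bij (edges G)"
      and fg: "\<And>e. e \<in> edges G \<Longrightarrow> ends G (g e) = f ` ends G e"
      by (auto simp: automorphisms_def)
    have inv: "inv\<^bsub>?P\<^esub> a = (\<lambda>x\<in>verts G. inv_into (verts G) f x, \<lambda>x\<in>edges G. inv_into (edges G) g x)"
      (is "_ = (?f', ?g')")
      using f g by (intro P.inv_equality)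
        (auto simp: a BijGroup_def restrict_inv_into_Bij Bij_compose_restrict_eq)
    have "ends G (?g' e) = ?f' ` ends G e" if e: "e \<in> edges G" for e
    proof -
      have e': "?g' e \<in> edges G" "g (?g' e) = e"
        using g e by (auto simp: Bij_def bij_betw_def inv_into_into f_inv_into_f)
      then have "ends G e = f ` ends G (?g' e)"
        using fg by metis
      moreover have "?f' (f v) = v" if "v \<in> ends G (?g' e)" for v
        using that f ends_subset[OF e'(1)] by (auto simp: Bij_def bij_betw_def)
      ultimately show ?thesis
        by (simp add: image_image del: restrict_apply)
    qed
    then show "inv\<^bsub>?P\<^esub> a \<in> automorphisms G"
      using f g by (auto simp: inv automorphisms_def restrict_inv_into_Bij)
  next
    fix a b assume "a \<in> automorphisms G" "b \<in> automorphisms G"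
    then obtain f g f' g' where ab: "a = (f, g)" "b = (f', g')"
      and f: "f \<in> Bij (verts G)" "f' \<in> Bij (verts G)"
      and g: "g \<in> Bij (edges G)" "g' \<in> Bij (edges G)"
      and fg: "\<And>e. e \<in> edges G \<Longrightarrow> ends G (g e) = f ` ends G e"
      and fg': "\<And>e. e \<in> edges G \<Longrightarrow> ends G (g' e) = f' ` ends G e"
      by (auto simp: automorphisms_def)
    have "ends G (compose (edges G) g g' e) = compose (verts G) f f' ` ends G e"
      if e: "e \<in> edges G" for e
    proof -
      have "g' e \<in> edges G"
        using g(2) e Bij_imp_funcset by blast
      moreover have "compose (verts G) f f' ` ends G e = f ` f' ` ends G e"
        unfolding image_image using ends_subset[OF e] by (intro image_cong) (auto simp: compose_def)
      ultimately show ?thesis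
        using e fg fg' by (simp add: compose_def)
    qed
    then show "a \<otimes>\<^bsub>?P\<^esub> b \<in> automorphisms G"
      using f g by (auto simp: ab automorphisms_def BijGroup_def compose_Bij)
  qed
  then show ?thesis
    unfolding AutGroup_def by (rule subgroup.subgroup_is_group) (rule P.group_axioms)
qed

definition periodic :: "nat \<Rightarrow> ('v, 'e) multigraph \<Rightarrow> bool" where
  "periodic p G \<longleftrightarrow> p \<ge> 2 \<and>
     (\<exists>h\<in>carrier (AutGroup G). group.ord (AutGroup G) h = p \<and>
        (\<forall>k\<in>generate (AutGroup G) {h}. k \<noteq> \<one>\<^bsub>AutGroup G\<^esub> \<longrightarrow>
           (\<forall>e\<in>edges G. snd k e \<noteq> e)))"


section \<open>The Negami polynomial\<close>

text \<open>
  The ring of integer polynomials in \<open>u\<close>, \<open>x\<close>, \<open>y\<close> is the monoid ring of the additive monoid of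
  exponent triples: \<open>(i, a, b)\<close> stands for the monomial with exponents \<open>i\<close> of \<open>u\<close>, \<open>a\<close> of \<open>x\<close> and
  \<open>b\<close> of \<open>y\<close>, and \<open>Poly_Mapping.lookup P (i, a, b)\<close> is its coefficient in \<open>P\<close>.
\<close>

type_synonym poly_uxy = "(nat \<times> nat \<times> nat) \<Rightarrow>\<^sub>0 int"

definition var_u :: poly_uxy where "var_u = Poly_Mapping.single (1, 0, 0) 1"
definition var_x :: poly_uxy where "var_x = Poly_Mapping.single (0, 1, 0) 1"
definition var_y :: poly_uxy where "var_y = Poly_Mapping.single (0, 0, 1) 1"

definition negami :: "('v, 'e) multigraph \<Rightarrow> poly_uxy" where
  "negami G = (\<Sum>Y\<in>Pow (edges G).
     var_u ^ num_components (delete_edges G Y) * var_x ^ (card (edges G) - card Y) * var_y ^ card Y)"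

end

theory Submission
  imports Defs
begin

text \<open>
  The coefficient of \<open>u\<^sup>i x\<^sup>a y\<^sup>b\<close> counts the edge sets of size \<open>b\<close> whose removal leaves \<open>i\<close>
  components.  The automorphism of order \<open>p\<close> acts on these edge sets, so if \<open>p\<close> does not divide
  their number, one of them is invariant.  As the action on edges is free, an invariant edge set is a
  disjoint union of orbits of size \<open>p\<close>, whence \<open>p\<close> divides \<open>b\<close>.
\<close>

section \<open>Orbits of maps of prime period\<close>

lemma funpow_mult_fixed:
  assumes "(f ^^ n) x = x"
  shows "(f ^^ (n * k)) x = x"
  using assms by (induction k) (simp_all add: funpow_add)

text \<open>By Bezout some multiple of \<open>m\<close> exceeds a multiple of \<open>n\<close> by
  one. Iterating either number of times fixes \<open>x\<close>, hence so does the one step by which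
  they differ. If \<open>m = 0\<close>, coprimality forces \<open>n = 1\<close>.\<close>

lemma funpow_coprime_fixed:
  assumes "coprime m n" "(f ^^ m) x = x" "(f ^^ n) x = x"
  shows "f x = x"
proof (cases "m = 0")
  case True
  then show ?thesis
    using assms by simp
next
  case False
  then obtain a b where "m * a = n * b + 1"
    using bezout_nat[OF False, of n] assms(1) by auto
  then have "f ((f ^^ (n * b)) x) = x"
    using funpow_mult_fixed[OF assms(2), of a] by simp
  then show ?thesis
    using funpow_mult_fixed[OF assms(3)] by simp
qed

text \<open>The orbits partition \<open>A\<close>, and each has exactly \<open>p\<close> elements: a
  shorter orbit would be fixed by an iterate coprime to \<open>p\<close> and so consist of fixed
  points. The lemma serves twice below, for a family of edge sets and for the edges of a single
  set.\<close>

lemma prime_dvd_card_fixpoint_free: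
  fixes f :: "'a \<Rightarrow> 'a"
  assumes "prime p" "finite A" and closed: "f \<in> A \<rightarrow> A"
    and period: "\<And>x. x \<in> A \<Longrightarrow> (f ^^ p) x = x"
    and free: "\<And>x. x \<in> A \<Longrightarrow> f x \<noteq> x"
  shows "p dvd card A"
proof -
  \<comment> \<open>Only forward iterates are allowed; the relation is symmetric because
    \<open>f ^^ (p - n)\<close> undoes \<open>f ^^ n\<close>.\<close>
  define r where "r = {(x, y). x \<in> A \<and> (\<exists>n. y = (f ^^ n) x)}"
  have "p > 0"
    using \<open>prime p\<close> by (rule prime_gt_0_nat)
  have in_A: "(f ^^ n) x \<in> A" if "x \<in> A" for n x
    using that closed by (induction n) auto
  have inj: "inj_on (\<lambda>n. (f ^^ n) x) {..<p}" if x: "x \<in> A" for x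
  proof (rule linorder_inj_onI)
    fix m n assume mn: "m < n" "m \<in> {..<p}" "n \<in> {..<p}"
    show "(f ^^ m) x \<noteq> (f ^^ n) x"
    proof
      assume "(f ^^ m) x = (f ^^ n) x"
      moreover have "(f ^^ (n - m + m)) x = (f ^^ (n - m)) ((f ^^ m) x)"
        by (simp only: funpow_add o_apply)
      ultimately have "(f ^^ (n - m)) ((f ^^ m) x) = (f ^^ m) x"
        using mn(1) by simp
      \<comment> \<open>Since \<open>0 < n - m < p\<close>, the prime \<open>p\<close> does not
        divide the difference.\<close>
      moreover have "coprime (n - m) p"
        using mn \<open>prime p\<close> by (metis coprime_commute diff_less_mono2 dvd_imp_le lessThan_iff
          less_imp_diff_less not_le prime_imp_coprime zero_less_diff)
      ultimately show False
        using funpow_coprime_fixed period free in_A[OF x] by metis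
    qed
  qed auto
  have class_eq: "r `` {x} = (\<lambda>n. (f ^^ n) x) ` {..<p}" if "x \<in> A" for x
  proof -
    have "(f ^^ n) x \<in> (\<lambda>n. (f ^^ n) x) ` {..<p}" for n
      using funpow_mod_eq[OF period[OF that], of n] \<open>p > 0\<close> by (intro image_eqI[of _ _ "n mod p"]) simp_all
    then show ?thesis
      using that by (auto simp: r_def)
  qed
  have "equiv A r"
  proof (rule equivI)
    show "refl_on A r"
      by (auto simp: refl_on_def r_def intro!: exI[of _ 0])
    show "sym r"
    proof (rule symI)
      fix x y assume xy: "(x, y) \<in> r"
      then have "x \<in> A" "y \<in> r `` {x}"
        by (auto simp: r_def)
      then obtain n where n: "n < p" "y = (f ^^ n) x"
        using class_eq by auto
      have "(f ^^ (p - n)) y = (f ^^ (p - n + n)) x"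
        by (simp only: n(2) funpow_add o_apply)
      then have "x = (f ^^ (p - n)) y"
        using n(1) period[OF \<open>x \<in> A\<close>] by simp
      then show "(y, x) \<in> r"
        using in_A[OF \<open>x \<in> A\<close>, of n] n(2) by (auto simp: r_def)
    qed
    show "trans r"
    proof (rule transI)
      fix x y z assume "(x, y) \<in> r" "(y, z) \<in> r"
      then obtain m n where "x \<in> A" "z = (f ^^ n) ((f ^^ m) x)"
        by (auto simp: r_def)
      then have "z = (f ^^ (n + m)) x"
        by (simp add: funpow_add)
      then show "(x, z) \<in> r"
        using \<open>x \<in> A\<close> unfolding r_def by blast
    qed
    show "r \<subseteq> A \<times> A"
      using in_A by (auto simp: r_def)
  qed
  then show ?thesis
  proof (rule equiv_imp_dvd_card[OF \<open>finite A\<close>])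
    fix X assume "X \<in> A // r"
    then obtain x where "x \<in> A" "X = r `` {x}"
      by (auto elim: quotientE)
    then show "p dvd card X"
      using class_eq inj by (simp add: card_image)
  qed
qed

section \<open>Isomorphism invariance of the number of components\<close>

lemma adjacency_iff: "(a, b) \<in> adjacency G \<longleftrightarrow> (\<exists>e\<in>edges G. ends G e = {a, b})"
  by (simp add: adjacency_def)

text \<open>Edges, and therefore walks, are carried along \<open>f\<close> in one direction and
  along its inverse in the other, so taking images under \<open>f\<close> is a bijection between the
  component classes.\<close>

lemma num_components_iso:
  assumes f: "bij_betw f (verts G) (verts H)" and g: "bij_betw g (edges G) (edges H)"
    and ends: "\<And>e. e \<in> edges G \<Longrightarrow> ends G e \<subseteq> verts G"
    and compat: "\<And>e. e \<in> edges G \<Longrightarrow> ends H (g e) = f ` ends G e"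
  shows "num_components H = num_components G"
proof -
  define f' where "f' = inv_into (verts G) f"
  have f': "f' (f v) = v" if "v \<in> verts G" for v
    using f that by (simp add: f'_def bij_betw_def)
  have adj: "(f a, f b) \<in> adjacency H" if ab: "(a, b) \<in> adjacency G" for a b
  proof -
    obtain e where "e \<in> edges G" "ends G e = {a, b}"
      using ab unfolding adjacency_iff by blast
    then have "g e \<in> edges H" "ends H (g e) = {f a, f b}"
      using compat bij_betwE[OF g] by simp_all
    then show ?thesis
      unfolding adjacency_iff by (intro bexI)
  qed
  have adj': "(f' c, f' d) \<in> adjacency G" if cd: "(c, d) \<in> adjacency H" for c d
  proof -
    \<comment> \<open>Every edge of \<open>H\<close> comes from an edge of \<open>G\<close>, whose
      end points are vertices of \<open>G\<close>; there \<open>f'\<close> cancels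
      \<open>f\<close>.\<close>
    have "\<exists>e\<in>g ` edges G. ends H e = {c, d}"
      using cd unfolding adjacency_iff bij_betw_imp_surj_on[OF g] .
    then obtain e where e: "e \<in> edges G" "ends H (g e) = {c, d}"
      by (elim bexE imageE) simp
    have "{f' c, f' d} = f' ` f ` ends G e"
      unfolding compat[OF e(1), symmetric] e(2) by simp
    also have "\<dots> = (\<lambda>v. v) ` ends G e"
      unfolding image_image using f' ends[OF e(1)] by (intro image_cong) auto
    finally have "ends G e = {f' c, f' d}"
      by simp
    then show ?thesis
      unfolding adjacency_iff using e(1) by (intro bexI[of _ e])
  qed
  have walk: "(f' c, f' d) \<in> (adjacency G)\<^sup>*" if "(c, d) \<in> (adjacency H)\<^sup>*" for c d
    using that
  proof induction
    case (step d e)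
    from step.IH adj'[OF step.hyps(2)] show ?case
      by (rule rtrancl_into_rtrancl)
  qed simp
  have conn: "(f a, f b) \<in> connectivity H \<longleftrightarrow> (a, b) \<in> connectivity G"
    if "a \<in> verts G" "b \<in> verts G" for a b
  proof -
    have "(f a, f b) \<in> (adjacency H)\<^sup>* \<longleftrightarrow> (a, b) \<in> (adjacency G)\<^sup>*"
    proof
      assume "(f a, f b) \<in> (adjacency H)\<^sup>*"
      then have "(f' (f a), f' (f b)) \<in> (adjacency G)\<^sup>*"
        by (rule walk)
      then show "(a, b) \<in> (adjacency G)\<^sup>*"
        using that f' by simp
    next
      assume "(a, b) \<in> (adjacency G)\<^sup>*"
      then show "(f a, f b) \<in> (adjacency H)\<^sup>*"
      proof induction
        case (step b c)
        from step.IH adj[OF step.hyps(2)] show ?case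
          by (rule rtrancl_into_rtrancl)
      qed simp
    qed
    then show ?thesis
      using that bij_betwE[OF f] by (simp add: connectivity_def)
  qed
  have cls: "connectivity H `` {f a} = f ` (connectivity G `` {a})" if a: "a \<in> verts G" for a
  proof (intro equalityI subsetI)
    fix d assume d: "d \<in> connectivity H `` {f a}"
    then have "d \<in> verts H"
      by (simp add: connectivity_def)
    then obtain b where "b \<in> verts G" "d = f b"
      using f by (auto simp: bij_betw_def)
    then show "d \<in> f ` (connectivity G `` {a})"
      using d conn[OF a] by auto
  next
    fix d assume "d \<in> f ` (connectivity G `` {a})"
    then obtain b where b: "(a, b) \<in> connectivity G" "d = f b"
      by auto
    then have "b \<in> verts G"
      by (simp add: connectivity_def)
    then show "d \<in> connectivity H `` {f a}"
      using b conn[OF a] by auto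
  qed
  have "verts H // connectivity H = (\<lambda>a. connectivity H `` {f a}) ` verts G"
    unfolding bij_betw_imp_surj_on[OF f, symmetric] by (auto simp: quotient_def)
  also have "\<dots> = (\<lambda>a. f ` (connectivity G `` {a})) ` verts G"
    using cls by (intro image_cong) auto
  also have "\<dots> = (`) f ` (verts G // connectivity G)"
    by (auto simp: quotient_def)
  finally have "verts H // connectivity H = (`) f ` (verts G // connectivity G)" .
  \<comment> \<open>Distinct classes keep distinct images because all of them lie in
    \<open>verts G\<close>, where \<open>f\<close> is injective.\<close>
  moreover have "inj_on ((`) f) (verts G // connectivity G)"
  proof (rule inj_on_subset)
    show "inj_on ((`) f) (Pow (verts G))"
      using f by (simp add: bij_betw_def inj_on_image_Pow)
    show "verts G // connectivity G \<subseteq> Pow (verts G)"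
      by (auto simp: quotient_def connectivity_def)
  qed
  ultimately show ?thesis
    by (simp add: num_components_def card_image)
qed

text \<open>The automorphism restricts to an isomorphism between the two graphs, since
  \<open>g\<close> maps the complement of \<open>Y\<close> onto the complement of its image.\<close>

lemma (in finite_multigraph) num_components_delete_edges_image:
  assumes "(f, g) \<in> automorphisms G" and "Y \<subseteq> edges G"
  shows "num_components (delete_edges G (g ` Y)) = num_components (delete_edges G Y)"
proof (rule num_components_iso)
  have f: "bij_betw f (verts G) (verts G)" and g: "bij_betw g (edges G) (edges G)"
    using assms(1) by (auto simp: automorphisms_def Bij_def)
  show "bij_betw f (verts (delete_edges G Y)) (verts (delete_edges G (g ` Y)))"
    using f by (simp add: delete_edges_def)
  have "g ` (edges G - Y) = edges G - g ` Y"
    using inj_on_image_set_diff[of g "edges G" "edges G" Y] g assms(2)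
    by (auto simp: bij_betw_def)
  then show "bij_betw g (edges (delete_edges G Y)) (edges (delete_edges G (g ` Y)))"
    using g unfolding delete_edges_def by (auto simp: bij_betw_def intro: inj_on_subset)
qed (use assms(1) ends_subset in \<open>auto simp: delete_edges_def automorphisms_def\<close>)

section \<open>From group elements to permutations of the edges\<close>

lemma snd_pow_AutGroup:
  assumes "h \<in> carrier (AutGroup G)" and "e \<in> edges G"
  shows "snd (h [^]\<^bsub>AutGroup G\<^esub> n) e = (snd h ^^ n) e"
proof -
  have h: "fst h \<in> Bij (verts G)" "snd h \<in> Bij (edges G)"
    using assms(1) by (auto simp: AutGroup_def automorphisms_def)
  \<comment> \<open>The induction carries membership in \<open>Bij\<close> along, because the
    product in \<open>BijGroup\<close> is composition only on that carrier.\<close>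
  have "fst (h [^]\<^bsub>AutGroup G\<^esub> n) \<in> Bij (verts G) \<and> snd (h [^]\<^bsub>AutGroup G\<^esub> n) \<in> Bij (edges G) \<and>
        (\<forall>e\<in>edges G. snd (h [^]\<^bsub>AutGroup G\<^esub> n) e = (snd h ^^ n) e)"
  proof (induction n)
    case 0
    show ?case
      using id_Bij[of "verts G"] id_Bij[of "edges G"]
      by (simp add: AutGroup_def DirProd_def BijGroup_def restrict_def)
  next
    case (Suc n)
    have mult: "a \<otimes>\<^bsub>AutGroup G\<^esub> b =
        (compose (verts G) (fst a) (fst b), compose (edges G) (snd a) (snd b))"
      if "fst a \<in> Bij (verts G)" "snd a \<in> Bij (edges G)"
         "fst b \<in> Bij (verts G)" "snd b \<in> Bij (edges G)" for a b
      using that by (auto simp: AutGroup_def DirProd_def BijGroup_def split: prod.splits)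
    have "snd h e \<in> edges G" if "e \<in> edges G" for e
      using Bij_imp_funcset[OF h(2)] that by blast
    then show ?case
      using Suc h by (auto simp: mult compose_Bij compose_eq funpow_swap1)
  qed
  then show ?thesis
    using assms(2) by blast
qed

text \<open>This extracts from a generator of the cyclic group the two facts on which the orbit
  count rests, phrased with plain iteration of functions.\<close>

lemma (in finite_multigraph) periodicE:
  assumes "periodic p G"
  obtains f g where "(f, g) \<in> automorphisms G"
    and "\<forall>e\<in>edges G. (g ^^ p) e = e"
    and "\<forall>e\<in>edges G. g e \<noteq> e"
proof -
  interpret A: group "AutGroup G"
    by (rule group_AutGroup)
  obtain h where "p \<ge> 2" and h: "h \<in> carrier (AutGroup G)" "A.ord h = p"
    and free: "\<And>k. k \<in> generate (AutGroup G) {h} \<Longrightarrow> k \<noteq> \<one>\<^bsub>AutGroup G\<^esub> \<Longrightarrow>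
      \<forall>e\<in>edges G. snd k e \<noteq> e"
    using assms by (auto simp: periodic_def)
  show thesis
  proof (rule that)
    show "(fst h, snd h) \<in> automorphisms G"
      using h(1) by (simp add: AutGroup_def)
    show "\<forall>e\<in>edges G. (snd h ^^ p) e = e"
    proof
      fix e assume e: "e \<in> edges G"
      have "h [^]\<^bsub>AutGroup G\<^esub> p = \<one>\<^bsub>AutGroup G\<^esub>"
        using A.pow_ord_eq_1[OF h(1)] h(2) by simp
      then have "(snd h ^^ p) e = snd \<one>\<^bsub>AutGroup G\<^esub> e"
        using snd_pow_AutGroup[OF h(1) e] by metis
      then show "(snd h ^^ p) e = e"
        using e by (simp add: AutGroup_def DirProd_def BijGroup_def)
    qed
    \<comment> \<open>Order at least 2 makes the generator itself a nontrivial element, so freeness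
      applies to it.\<close>
    have "h \<noteq> \<one>\<^bsub>AutGroup G\<^esub>"
      using h(2) \<open>p \<ge> 2\<close> A.ord_eq_1[OF h(1)] by auto
    then show "\<forall>e\<in>edges G. snd h e \<noteq> e"
      using free[of h] by (simp add: generate.incl)
  qed
qed

section \<open>Coefficients of the Negami polynomial\<close>

lemma monomial_uxy:
  "var_u ^ i * var_x ^ a * var_y ^ b = Poly_Mapping.single (i, a, b) 1"
proof -
  have one: "Poly_Mapping.single (0, 0, 0) 1 = (1 :: poly_uxy)"
    by (simp only: single_one flip: zero_prod_def)
  have "var_u ^ i = Poly_Mapping.single (i, 0, 0) 1"
    by (induction i) (simp_all add: var_u_def mult_single one)
  moreover have "var_x ^ a = Poly_Mapping.single (0, a, 0) 1"
    by (induction a) (simp_all add: var_x_def mult_single one)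
  moreover have "var_y ^ b = Poly_Mapping.single (0, 0, b) 1"
    by (induction b) (simp_all add: var_y_def mult_single one)
  ultimately show ?thesis
    by (simp add: mult_single)
qed

lemma of_int_mult_single:
  "of_int c * Poly_Mapping.single k 1 = Poly_Mapping.single k c"
  by (subst single_of_int[symmetric], subst mult_single) simp

text \<open>Each edge set contributes a single monomial with coefficient 1, so equal monomials
  simply accumulate.\<close>

lemma (in finite_multigraph) lookup_negami:
  "Poly_Mapping.lookup (negami G) (i, a, b) =
     int (card {Y \<in> Pow (edges G). num_components (delete_edges G Y) = i \<and>
       card (edges G) - card Y = a \<and> card Y = b})"
proof -
  have "Poly_Mapping.lookup (negami G) (i, a, b) =
      (\<Sum>Y\<in>Pow (edges G). if num_components (delete_edges G Y) = i \<and>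
         card (edges G) - card Y = a \<and> card Y = b then 1 else 0)"
    unfolding negami_def lookup_sum monomial_uxy lookup_single when_def
    by (rule sum.cong) auto
  also have "\<dots> = int (card {Y \<in> Pow (edges G). num_components (delete_edges G Y) = i \<and>
       card (edges G) - card Y = a \<and> card Y = b})"
    using finite_edges by (subst sum.inter_filter[symmetric]) simp_all
  finally show ?thesis .
qed

lemma (in finite_multigraph) negami_coeff_not_dvd:
  assumes "prime p" "periodic p G"
    and ndvd: "\<not> int p dvd Poly_Mapping.lookup (negami G) (i, a, b)"
  obtains j where "j * p \<le> card (edges G)" "a = card (edges G) - j * p" "b = j * p"
proof -
  obtain f g where fg: "(f, g) \<in> automorphisms G"
    and period: "\<forall>e\<in>edges G. (g ^^ p) e = e"
    and free: "\<forall>e\<in>edges G. g e \<noteq> e"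
    using periodicE[OF assms(2)] by blast
  have g: "bij_betw g (edges G) (edges G)"
    using fg by (auto simp: automorphisms_def Bij_def)
  define S where "S = {Y \<in> Pow (edges G). num_components (delete_edges G Y) = i \<and>
    card (edges G) - card Y = a \<and> card Y = b}"
  have "\<not> p dvd card S"
    using ndvd by (simp add: lookup_negami S_def)
  moreover have "finite S"
    using finite_edges by (simp add: S_def)
  moreover have "(`) g \<in> S \<rightarrow> S"
  proof
    fix Y assume Y: "Y \<in> S"
    then have "card (g ` Y) = card Y"
      using g by (intro card_image) (auto simp: S_def bij_betw_def intro: inj_on_subset)
    moreover have "g ` Y \<subseteq> edges G"
      using Y g by (auto simp: S_def bij_betw_def)
    ultimately show "g ` Y \<in> S"
      using Y num_components_delete_edges_image[OF fg, of Y] by (auto simp: S_def)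
  qed
  \<comment> \<open>Iterating the image map is the same as taking the image under the iterate, and
    \<open>g ^^ p\<close> is the identity on edges.\<close>
  moreover have "((`) g ^^ p) Y = Y" if "Y \<in> S" for Y
  proof -
    have "((`) g ^^ n) Y = (g ^^ n) ` Y" for n
      by (induction n) (simp_all add: image_comp)
    moreover have "(g ^^ p) ` Y = (\<lambda>e. e) ` Y"
      using that period by (intro image_cong) (auto simp: S_def)
    ultimately show ?thesis
      by simp
  qed
  \<comment> \<open>Contrapositive of the orbit count, applied to the action on edge sets.\<close>
  ultimately have "\<not> (\<forall>Y\<in>S. g ` Y \<noteq> Y)"
    using prime_dvd_card_fixpoint_free[OF assms(1), of S "(`) g"] by metis
  then obtain Y where Y: "Y \<in> S" "g ` Y = Y"
    by blast
  then have "Y \<subseteq> edges G"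
    by (simp add: S_def)
  \<comment> \<open>Second orbit count, now on the edges inside the invariant set, where
    \<open>g\<close> has no fixed point.\<close>
  have "p dvd card Y"
  proof (rule prime_dvd_card_fixpoint_free[OF assms(1), of Y g])
    show "finite Y"
      using \<open>Y \<subseteq> edges G\<close> finite_edges by (rule finite_subset)
    show "g \<in> Y \<rightarrow> Y"
      using Y(2) by blast
  qed (use \<open>Y \<subseteq> edges G\<close> period free in blast)+
  then obtain j where j: "card Y = j * p"
    by (metis dvd_def mult.commute)
  \<comment> \<open>This bound ensures that the subtraction of natural numbers in the exponent of
    \<open>x\<close> is not truncated.\<close>
  have "card Y \<le> card (edges G)"
    using finite_edges \<open>Y \<subseteq> edges G\<close> by (rule card_mono)
  then show thesis
    using Y(1) j by (intro that[of j]) (auto simp: S_def)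
qed

section \<open>Congruence modulo \<open>p\<close>\<close>

lemma poly_mapping_eq_sum_single:
  fixes P :: "'k \<Rightarrow>\<^sub>0 'r::comm_monoid_add"
  shows "P = (\<Sum>k\<in>Poly_Mapping.keys P. Poly_Mapping.single k (Poly_Mapping.lookup P k))"
  by (rule poly_mapping_eqI) (auto simp: lookup_sum lookup_single when_def in_keys_iff)

lemma of_nat_dvd_single:
  assumes "int p dvd c"
  shows "of_nat p dvd (Poly_Mapping.single k c :: 'k::comm_monoid_add \<Rightarrow>\<^sub>0 int)"
proof -
  obtain d where "c = int p * d"
    using assms by blast
  then have "Poly_Mapping.single k c = of_nat p * Poly_Mapping.single k d"
    by (subst single_of_nat[symmetric], subst mult_single) simp
  then show ?thesis
    by simp
qed

theorem theorem1p1: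
  fixes G :: "('v, 'e) multigraph" and p q :: nat
  assumes "prime p"
    and "finite_multigraph G"
    and "connected_multigraph G"
    and "periodic p G"
    and "card (edges G) = q"
  shows "(\<exists>(I :: (nat \<times> nat) set) (c :: nat \<Rightarrow> nat \<Rightarrow> int).
            finite I \<and> (\<forall>(i, j)\<in>I. j * p \<le> q) \<and>
            of_nat p dvd negami G -
              (\<Sum>(i, j)\<in>I. of_int (c i j) * var_u ^ i * var_x ^ (q - j * p) * var_y ^ (j * p)))
       \<and> (\<forall>i a b. \<not> int p dvd Poly_Mapping.lookup (negami G) (i, a, b) \<longrightarrow>
            (\<exists>j. j * p \<le> q \<and> a = q - j * p \<and> b = j * p))"
proof (rule conjI)
  interpret finite_multigraph G
    by (rule assms(2))
  let ?N = "negami G"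
  have "p > 0"
    using assms(1) by (rule prime_gt_0_nat)
  \<comment> \<open>The second conjunct comes first, since the congruence is deduced from
    it.\<close>
  show coeffs: "\<forall>i a b. \<not> int p dvd Poly_Mapping.lookup ?N (i, a, b) \<longrightarrow>
      (\<exists>j. j * p \<le> q \<and> a = q - j * p \<and> b = j * p)"
  proof (intro allI impI)
    fix i a b assume "\<not> int p dvd Poly_Mapping.lookup ?N (i, a, b)"
    then obtain j where "j * p \<le> card (edges G)" "a = card (edges G) - j * p" "b = j * p"
      by (rule negami_coeff_not_dvd[OF assms(1,4)])
    then show "\<exists>j. j * p \<le> q \<and> a = q - j * p \<and> b = j * p"
      unfolding assms(5) by (intro exI[of _ j] conjI)
  qed
  \<comment> \<open>\<open>expo\<close> turns an index pair into its exponent triple. The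
    approximating sum collects exactly the terms of \<open>?N\<close> with exponents of the required
    form, keeping their integer coefficients.\<close>
  define expo where "expo = (\<lambda>(i, j). (i :: nat, q - j * p, j * p))"
  define I where "I = {(i, j). j * p \<le> q \<and> expo (i, j) \<in> Poly_Mapping.keys ?N}"
  define c where "c = (\<lambda>i j. Poly_Mapping.lookup ?N (expo (i, j)))"
  \<comment> \<open>As \<open>p > 0\<close>, the index \<open>j\<close> can be recovered from
    \<open>j * p\<close>.\<close>
  have inj: "inj expo"
    using \<open>p > 0\<close> by (auto simp: inj_def expo_def)
  have sub: "expo ` I \<subseteq> Poly_Mapping.keys ?N"
    by (auto simp: I_def)
  then have "finite I"
    using inj by (metis finite_imageD finite_keys finite_subset inj_on_subset subset_UNIV)
  have "(\<Sum>(i, j)\<in>I. of_int (c i j) * var_u ^ i * var_x ^ (q - j * p) * var_y ^ (j * p)) =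
      (\<Sum>k\<in>I. Poly_Mapping.single (expo k) (Poly_Mapping.lookup ?N (expo k)))"
    by (intro sum.cong)
      (auto simp: c_def expo_def mult.assoc of_int_mult_single monomial_uxy[unfolded mult.assoc])
  also have "\<dots> = (\<Sum>k\<in>expo ` I. Poly_Mapping.single k (Poly_Mapping.lookup ?N k))"
    using inj by (simp add: sum.reindex inj_on_subset)
  finally have "?N - (\<Sum>(i, j)\<in>I. of_int (c i j) * var_u ^ i * var_x ^ (q - j * p) * var_y ^ (j * p)) =
      (\<Sum>k\<in>Poly_Mapping.keys ?N - expo ` I. Poly_Mapping.single k (Poly_Mapping.lookup ?N k))"
    using sub by (simp add: sum_diff flip: poly_mapping_eq_sum_single)
  \<comment> \<open>A remaining term with coefficient not divisible by \<open>p\<close> would have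
    exponents of the required form by \<open>coeffs\<close>, and would thus already have been
    subtracted.\<close>
  moreover have "of_nat p dvd \<dots>"
  proof (intro dvd_sum of_nat_dvd_single)
    fix k assume k: "k \<in> Poly_Mapping.keys ?N - expo ` I"
    obtain i a b where iab: "k = (i, a, b)"
      by (metis prod_cases3)
    show "int p dvd Poly_Mapping.lookup ?N k"
    proof (rule ccontr)
      assume "\<not> ?thesis"
      then obtain j where "j * p \<le> q" "a = q - j * p" "b = j * p"
        using coeffs unfolding iab by blast
      then have "j * p \<le> q" "k = expo (i, j)"
        by (simp_all add: iab expo_def)
      then show False
        using k by (auto simp: I_def)
    qed
  qed
  ultimately have "of_nat p dvd ?N -
      (\<Sum>(i, j)\<in>I. of_int (c i j) * var_u ^ i * var_x ^ (q - j * p) * var_y ^ (j * p))"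
    by simp
  then show "\<exists>(I :: (nat \<times> nat) set) (c :: nat \<Rightarrow> nat \<Rightarrow> int).
      finite I \<and> (\<forall>(i, j)\<in>I. j * p \<le> q) \<and>
      of_nat p dvd ?N -
        (\<Sum>(i, j)\<in>I. of_int (c i j) * var_u ^ i * var_x ^ (q - j * p) * var_y ^ (j * p))"
    using \<open>finite I\<close> by (intro exI[of _ I] exI[of _ c]) (auto simp: I_def)
qed

end
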